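(* Let $\mathrm{pa16}_3$ be the sentence $\forall x\,\exists q\,\exists r\,(r<3\land x=q\cdot3+r)$. Then $$\mathrm{PA}_{\mathrm{smu}}^{-}\cup\operatorname{Th}_{\forall}(\mathfrak N_0)\nvdash\mathrm{pa16}_3.$$ Consequently, $\mathrm{PA}_{\mathrm{smu}}^{-}\cup\operatorname{Th}_{\forall}(\mathfrak N_0)$ does not prove the scheme $\mathrm{pa16}$ (that is, it does not prove all of its instances); in particular, neither does $\mathrm{PA}_{\mathrm{smu}}^{-}$.
   Context: The base language is $\mathcal L_0=\{0,1,+,\cdot,\le\}$ (first-order logic with equality). Abbreviations: $2:=1+1$; $3:=2+1$; $x<y$ means $x\le y\land x\ne y$; $x\mid y$ means $\exists z\,(z\cdot x=y)$; $\operatorname{pow}_2(x)$ means $\forall y\,(y\mid x\rightarrow(y=1\lor 2\mid y))$. $\mathrm{PA}_{\mathrm{smu}}^{-}$ is the $\mathcal L_0$-theory whose axioms are the universal closures of: (pa1) $x+0=x$; (pa2) $x+y=y+x$; (pa3) $(x+y)+z=x+(y+z)$; (pa4) $x\cdot1=x$; (pa5) $x\cdot y=y\cdot x$; (pa6) $(x\cdot y)\cdot z=x\cdot(y\cdot z)$; (pa7) $x\cdot(y+z)=x\cdot y+x\cdot z$; (pa8) $x\le y\lor y\le x$; (pa9) $(x\le y\land y\le z)\rightarrow x\le z$; (pa10) $\neg(x+1\le x)$; (pa11) $y\le x\rightarrow(y=x\lor y+1\le x)$; (pa12) $y\le x\rightarrow y+z\le x+z$; (pa13) $y\le x\rightarrow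 y\cdot z\le x\cdot z$; (pa15) $y\le x\rightarrow\exists z\,(x=y+z)$; (pa19) $\exists u\,(\operatorname{pow}_2(u)\land u\le x+1\land x+1<2\cdot u)$; (pa20) $(\operatorname{pow}_2(x)\land\operatorname{pow}_2(y)\land x\le y)\rightarrow x\mid y$. $\mathfrak N_0=(\mathbb N;0,1,+,\cdot,\le)$ is the standard model ($0\in\mathbb N$). $\operatorname{Th}_{\forall}(\mathfrak N_0)$ is the set of all universal $\mathcal L_0$-sentences (a block of universal quantifiers followed by a quantifier-free formula) true in $\mathfrak N_0$. $\overline n$ denotes the $\mathcal L_0$-numeral for the standard natural number $n$. The Standard Euclidean Division Principle $\mathrm{pa16}$ is the scheme consisting, for every $n\in\mathbb N\setminus\{0\}$, of the sentence $\forall x\,\exists q\,\exists r\,(r<\overline n\land x=q\cdot\overline n+r)$; $\mathrm{pa16}_3$ is its $n=3$ instance. $\vdash$ is provability in first-order logic with equality. *)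

theory Defs
  imports Main
begin

section \<open>First-order logic over the language of ordered semirings\<close>

text \<open>
  Variables are de Bruijn indices: inside a quantifier, \<open>Var 0\<close> is the variable it binds
  and \<open>Var (Suc i)\<close> is the outer variable \<open>i\<close>. Symbols of the object language are in bold.
\<close>

datatype tm =
    Var nat
  | Zero  ("\<^bold>0")
  | One  ("\<^bold>1")
  | Add tm tm  (infixl "\<^bold>+" 65)
  | Mul tm tm  (infixl "\<^bold>*" 70)

datatype fm =
    Eq tm tm  (infix "\<^bold>=" 50)
  | Le tm tm  (infix "\<^bold>\<le>" 50)
  | Neg fm  ("\<^bold>\<not> _" [40] 40)
  | Conj fm fm  (infixr "\<^bold>\<and>" 35)
  | Disj fm fm  (infixr "\<^bold>\<or>" 30)
  | Imp fm fm  (infixr "\<^bold>\<longrightarrow>" 25)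
  | All fm
  | Ex fm

primrec subst_tm :: "(nat \<Rightarrow> tm) \<Rightarrow> tm \<Rightarrow> tm" where
  "subst_tm \<sigma> (Var i) = \<sigma> i"
| "subst_tm \<sigma> \<^bold>0 = \<^bold>0"
| "subst_tm \<sigma> \<^bold>1 = \<^bold>1"
| "subst_tm \<sigma> (s \<^bold>+ t) = subst_tm \<sigma> s \<^bold>+ subst_tm \<sigma> t"
| "subst_tm \<sigma> (s \<^bold>* t) = subst_tm \<sigma> s \<^bold>* subst_tm \<sigma> t"

definition lift_tm :: "tm \<Rightarrow> tm" where
  "lift_tm = subst_tm (\<lambda>i. Var (Suc i))"

definition under_binder :: "(nat \<Rightarrow> tm) \<Rightarrow> nat \<Rightarrow> tm" where
  "under_binder \<sigma> = case_nat (Var 0) (\<lambda>i. lift_tm (\<sigma> i))"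

primrec subst_fm :: "(nat \<Rightarrow> tm) \<Rightarrow> fm \<Rightarrow> fm" where
  "subst_fm \<sigma> (s \<^bold>= t) = (subst_tm \<sigma> s \<^bold>= subst_tm \<sigma> t)"
| "subst_fm \<sigma> (s \<^bold>\<le> t) = (subst_tm \<sigma> s \<^bold>\<le> subst_tm \<sigma> t)"
| "subst_fm \<sigma> (\<^bold>\<not> \<phi>) = (\<^bold>\<not> subst_fm \<sigma> \<phi>)"
| "subst_fm \<sigma> (\<phi> \<^bold>\<and> \<psi>) = (subst_fm \<sigma> \<phi> \<^bold>\<and> subst_fm \<sigma> \<psi>)"
| "subst_fm \<sigma> (\<phi> \<^bold>\<or> \<psi>) = (subst_fm \<sigma> \<phi> \<^bold>\<or> subst_fm \<sigma> \<psi>)"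
| "subst_fm \<sigma> (\<phi> \<^bold>\<longrightarrow> \<psi>) = (subst_fm \<sigma> \<phi> \<^bold>\<longrightarrow> subst_fm \<sigma> \<psi>)"
| "subst_fm \<sigma> (All \<phi>) = All (subst_fm (under_binder \<sigma>) \<phi>)"
| "subst_fm \<sigma> (Ex \<phi>) = Ex (subst_fm (under_binder \<sigma>) \<phi>)"

definition lift_fm :: "fm \<Rightarrow> fm" where
  "lift_fm = subst_fm (\<lambda>i. Var (Suc i))"

text \<open>\<open>inst t \<phi>\<close> replaces variable 0 of the body \<open>\<phi>\<close> of a quantifier by \<open>t\<close>.\<close>

definition inst :: "tm \<Rightarrow> fm \<Rightarrow> fm" where
  "inst t = subst_fm (case_nat t Var)"

text \<open>The free variables of \<open>\<phi>\<close> are all below \<open>fv_bound \<phi>\<close>, and this is the least such bound.\<close>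

primrec fv_bound_tm :: "tm \<Rightarrow> nat" where
  "fv_bound_tm (Var i) = Suc i"
| "fv_bound_tm \<^bold>0 = 0"
| "fv_bound_tm \<^bold>1 = 0"
| "fv_bound_tm (s \<^bold>+ t) = max (fv_bound_tm s) (fv_bound_tm t)"
| "fv_bound_tm (s \<^bold>* t) = max (fv_bound_tm s) (fv_bound_tm t)"

primrec fv_bound :: "fm \<Rightarrow> nat" where
  "fv_bound (s \<^bold>= t) = max (fv_bound_tm s) (fv_bound_tm t)"
| "fv_bound (s \<^bold>\<le> t) = max (fv_bound_tm s) (fv_bound_tm t)"
| "fv_bound (\<^bold>\<not> \<phi>) = fv_bound \<phi>"
| "fv_bound (\<phi> \<^bold>\<and> \<psi>) = max (fv_bound \<phi>) (fv_bound \<psi>)"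
| "fv_bound (\<phi> \<^bold>\<or> \<psi>) = max (fv_bound \<phi>) (fv_bound \<psi>)"
| "fv_bound (\<phi> \<^bold>\<longrightarrow> \<psi>) = max (fv_bound \<phi>) (fv_bound \<psi>)"
| "fv_bound (All \<phi>) = fv_bound \<phi> - 1"
| "fv_bound (Ex \<phi>) = fv_bound \<phi> - 1"

definition sentence :: "fm \<Rightarrow> bool" where
  "sentence \<phi> \<longleftrightarrow> fv_bound \<phi> = 0"

definition universal_closure :: "fm \<Rightarrow> fm" where
  "universal_closure \<phi> = (All ^^ fv_bound \<phi>) \<phi>"

primrec quantifier_free :: "fm \<Rightarrow> bool" where
  "quantifier_free (s \<^bold>= t) = True"
| "quantifier_free (s \<^bold>\<le> t) = True"
| "quantifier_free (\<^bold>\<not> \<phi>) = quantifier_free \<phi>"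
| "quantifier_free (\<phi> \<^bold>\<and> \<psi>) = (quantifier_free \<phi> \<and> quantifier_free \<psi>)"
| "quantifier_free (\<phi> \<^bold>\<or> \<psi>) = (quantifier_free \<phi> \<and> quantifier_free \<psi>)"
| "quantifier_free (\<phi> \<^bold>\<longrightarrow> \<psi>) = (quantifier_free \<phi> \<and> quantifier_free \<psi>)"
| "quantifier_free (All \<phi>) = False"
| "quantifier_free (Ex \<phi>) = False"


subsection \<open>Provability\<close>

text \<open>
  Classical natural deduction with equality. The assumption set may be infinite; a derivation is
  finite and uses only finitely many assumptions. Lifting the assumptions in \<open>AllI\<close> and \<open>ExE\<close>
  makes variable 0 fresh: this is the eigenvariable condition.
\<close>

inductive proves :: "fm set \<Rightarrow> fm \<Rightarrow> bool"  (infix "\<turnstile>" 20) where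
  Hyp: "\<phi> \<in> \<Gamma> \<Longrightarrow> \<Gamma> \<turnstile> \<phi>"
| NegI: "insert \<phi> \<Gamma> \<turnstile> \<psi> \<Longrightarrow> insert \<phi> \<Gamma> \<turnstile> \<^bold>\<not> \<psi> \<Longrightarrow> \<Gamma> \<turnstile> \<^bold>\<not> \<phi>"
| RAA: "insert (\<^bold>\<not> \<phi>) \<Gamma> \<turnstile> \<psi> \<Longrightarrow> insert (\<^bold>\<not> \<phi>) \<Gamma> \<turnstile> \<^bold>\<not> \<psi> \<Longrightarrow> \<Gamma> \<turnstile> \<phi>"
| ConjI: "\<Gamma> \<turnstile> \<phi> \<Longrightarrow> \<Gamma> \<turnstile> \<psi> \<Longrightarrow> \<Gamma> \<turnstile> \<phi> \<^bold>\<and> \<psi>"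
| ConjE1: "\<Gamma> \<turnstile> \<phi> \<^bold>\<and> \<psi> \<Longrightarrow> \<Gamma> \<turnstile> \<phi>"
| ConjE2: "\<Gamma> \<turnstile> \<phi> \<^bold>\<and> \<psi> \<Longrightarrow> \<Gamma> \<turnstile> \<psi>"
| DisjI1: "\<Gamma> \<turnstile> \<phi> \<Longrightarrow> \<Gamma> \<turnstile> \<phi> \<^bold>\<or> \<psi>"
| DisjI2: "\<Gamma> \<turnstile> \<psi> \<Longrightarrow> \<Gamma> \<turnstile> \<phi> \<^bold>\<or> \<psi>"
| DisjE: "\<Gamma> \<turnstile> \<phi> \<^bold>\<or> \<psi> \<Longrightarrow> insert \<phi> \<Gamma> \<turnstile> \<chi> \<Longrightarrow> insert \<psi> \<Gamma> \<turnstile> \<chi> \<Longrightarrow> \<Gamma> \<turnstile> \<chi>"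
| ImpI: "insert \<phi> \<Gamma> \<turnstile> \<psi> \<Longrightarrow> \<Gamma> \<turnstile> \<phi> \<^bold>\<longrightarrow> \<psi>"
| ImpE: "\<Gamma> \<turnstile> \<phi> \<^bold>\<longrightarrow> \<psi> \<Longrightarrow> \<Gamma> \<turnstile> \<phi> \<Longrightarrow> \<Gamma> \<turnstile> \<psi>"
| AllI: "lift_fm ` \<Gamma> \<turnstile> \<phi> \<Longrightarrow> \<Gamma> \<turnstile> All \<phi>"
| AllE: "\<Gamma> \<turnstile> All \<phi> \<Longrightarrow> \<Gamma> \<turnstile> inst t \<phi>"
| ExI: "\<Gamma> \<turnstile> inst t \<phi> \<Longrightarrow> \<Gamma> \<turnstile> Ex \<phi>"
| ExE: "\<Gamma> \<turnstile> Ex \<phi> \<Longrightarrow> insert \<phi> (lift_fm ` \<Gamma>) \<turnstile> lift_fm \<psi> \<Longrightarrow> \<Gamma> \<turnstile> \<psi>"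
| EqRefl: "\<Gamma> \<turnstile> t \<^bold>= t"
| EqSubst: "\<Gamma> \<turnstile> s \<^bold>= t \<Longrightarrow> \<Gamma> \<turnstile> inst s \<phi> \<Longrightarrow> \<Gamma> \<turnstile> inst t \<phi>"


subsection \<open>Truth in a structure\<close>

text \<open>The domain of a structure is its whole carrier type.\<close>

record 'a struct =
  zero_of :: 'a
  one_of :: 'a
  add_of :: "'a \<Rightarrow> 'a \<Rightarrow> 'a"
  mul_of :: "'a \<Rightarrow> 'a \<Rightarrow> 'a"
  le_of :: "'a \<Rightarrow> 'a \<Rightarrow> bool"

primrec eval :: "'a struct \<Rightarrow> (nat \<Rightarrow> 'a) \<Rightarrow> tm \<Rightarrow> 'a" where
  "eval M e (Var i) = e i"
| "eval M e \<^bold>0 = zero_of M"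
| "eval M e \<^bold>1 = one_of M"
| "eval M e (s \<^bold>+ t) = add_of M (eval M e s) (eval M e t)"
| "eval M e (s \<^bold>* t) = mul_of M (eval M e s) (eval M e t)"

primrec sat :: "'a struct \<Rightarrow> (nat \<Rightarrow> 'a) \<Rightarrow> fm \<Rightarrow> bool" where
  "sat M e (s \<^bold>= t) \<longleftrightarrow> eval M e s = eval M e t"
| "sat M e (s \<^bold>\<le> t) \<longleftrightarrow> le_of M (eval M e s) (eval M e t)"
| "sat M e (\<^bold>\<not> \<phi>) \<longleftrightarrow> \<not> sat M e \<phi>"
| "sat M e (\<phi> \<^bold>\<and> \<psi>) \<longleftrightarrow> sat M e \<phi> \<and> sat M e \<psi>"
| "sat M e (\<phi> \<^bold>\<or> \<psi>) \<longleftrightarrow> sat M e \<phi> \<or> sat M e \<psi>"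
| "sat M e (\<phi> \<^bold>\<longrightarrow> \<psi>) \<longleftrightarrow> (sat M e \<phi> \<longrightarrow> sat M e \<psi>)"
| "sat M e (All \<phi>) \<longleftrightarrow> (\<forall>a. sat M (case_nat a e) \<phi>)"
| "sat M e (Ex \<phi>) \<longleftrightarrow> (\<exists>a. sat M (case_nat a e) \<phi>)"

definition models :: "'a struct \<Rightarrow> fm \<Rightarrow> bool" where
  "models M \<phi> \<longleftrightarrow> (\<forall>e. sat M e \<phi>)"


section \<open>The theories\<close>

definition N0 :: "nat struct" where
  "N0 = \<lparr>zero_of = 0, one_of = 1, add_of = (+), mul_of = (*), le_of = (\<le>)\<rparr>"

definition Th_univ_N0 :: "fm set" where
  "Th_univ_N0 = {(All ^^ n) \<phi> | n \<phi>.
     quantifier_free \<phi> \<and> sentence ((All ^^ n) \<phi>) \<and> models N0 ((All ^^ n) \<phi>)}"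

primrec numeral_tm :: "nat \<Rightarrow> tm" where
  "numeral_tm 0 = \<^bold>0"
| "numeral_tm (Suc n) = (if n = 0 then \<^bold>1 else numeral_tm n \<^bold>+ \<^bold>1)"

abbreviation Two :: tm  ("\<^bold>2") where "\<^bold>2 \<equiv> \<^bold>1 \<^bold>+ \<^bold>1"
abbreviation Three :: tm  ("\<^bold>3") where "\<^bold>3 \<equiv> \<^bold>2 \<^bold>+ \<^bold>1"

definition Lt :: "tm \<Rightarrow> tm \<Rightarrow> fm"  (infix "\<^bold><" 50) where
  "(s \<^bold>< t) = (s \<^bold>\<le> t \<^bold>\<and> \<^bold>\<not> s \<^bold>= t)"

definition Dvd :: "tm \<Rightarrow> tm \<Rightarrow> fm"  (infix "\<^bold>dvd" 50) where
  "(s \<^bold>dvd t) = Ex (Var 0 \<^bold>* lift_tm s \<^bold>= lift_tm t)"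

definition Pow2 :: "tm \<Rightarrow> fm" where
  "Pow2 t = All (Var 0 \<^bold>dvd lift_tm t \<^bold>\<longrightarrow> Var 0 \<^bold>= \<^bold>1 \<^bold>\<or> \<^bold>2 \<^bold>dvd Var 0)"

text \<open>In the axioms with a leading or consequent \<open>Ex\<close>, the bound variable is \<open>Var 0\<close>, hence the lifted \<open>x\<close> and \<open>y\<close>.\<close>

definition PA_smu_minus :: "fm set" where
  "PA_smu_minus =
    (let x = Var 0; y = Var 1; z = Var 2 in universal_closure `
     {x \<^bold>+ \<^bold>0 \<^bold>= x,
      x \<^bold>+ y \<^bold>= y \<^bold>+ x,
      (x \<^bold>+ y) \<^bold>+ z \<^bold>= x \<^bold>+ (y \<^bold>+ z),
      x \<^bold>* \<^bold>1 \<^bold>= x,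
      x \<^bold>* y \<^bold>= y \<^bold>* x,
      (x \<^bold>* y) \<^bold>* z \<^bold>= x \<^bold>* (y \<^bold>* z),
      x \<^bold>* (y \<^bold>+ z) \<^bold>= x \<^bold>* y \<^bold>+ x \<^bold>* z,
      x \<^bold>\<le> y \<^bold>\<or> y \<^bold>\<le> x,
      x \<^bold>\<le> y \<^bold>\<and> y \<^bold>\<le> z \<^bold>\<longrightarrow> x \<^bold>\<le> z,
      \<^bold>\<not> x \<^bold>+ \<^bold>1 \<^bold>\<le> x,
      y \<^bold>\<le> x \<^bold>\<longrightarrow> y \<^bold>= x \<^bold>\<or> y \<^bold>+ \<^bold>1 \<^bold>\<le> x,
      y \<^bold>\<le> x \<^bold>\<longrightarrow> y \<^bold>+ z \<^bold>\<le> x \<^bold>+ z,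
      y \<^bold>\<le> x \<^bold>\<longrightarrow> y \<^bold>* z \<^bold>\<le> x \<^bold>* z,
      y \<^bold>\<le> x \<^bold>\<longrightarrow> Ex (lift_tm x \<^bold>= lift_tm y \<^bold>+ Var 0),
      Ex (Pow2 (Var 0) \<^bold>\<and> Var 0 \<^bold>\<le> lift_tm x \<^bold>+ \<^bold>1 \<^bold>\<and> lift_tm x \<^bold>+ \<^bold>1 \<^bold>< \<^bold>2 \<^bold>* Var 0),
      Pow2 x \<^bold>\<and> Pow2 y \<^bold>\<and> x \<^bold>\<le> y \<^bold>\<longrightarrow> x \<^bold>dvd y})"

text \<open>Under the quantifiers \<open>\<forall>x \<exists>q \<exists>r\<close>, the variables \<open>x\<close>, \<open>q\<close>, \<open>r\<close> have indices 2, 1, 0.\<close>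

definition pa16_instance :: "nat \<Rightarrow> fm" where
  "pa16_instance n = All (Ex (Ex
     (Var 0 \<^bold>< numeral_tm n \<^bold>\<and> Var 2 \<^bold>= Var 1 \<^bold>* numeral_tm n \<^bold>+ Var 0)))"

definition pa16 :: "fm set" where
  "pa16 = {pa16_instance n | n. n \<noteq> 0}"

definition pa16_3 :: fm where
  "pa16_3 = All (Ex (Ex (Var 0 \<^bold>< \<^bold>3 \<^bold>\<and> Var 2 \<^bold>= Var 1 \<^bold>* \<^bold>3 \<^bold>+ Var 0)))"

lemma pa16_3_eq: "pa16_3 = pa16_instance 3"
  by (simp add: pa16_3_def pa16_instance_def numeral_3_eq_3)

end

(*
  A model in which t is not of the form 3q + r is the nonnegative part of Z + t Z[1/2][t], ordered
  by t > Z. Substituting a large power of two for t turns finitely many of its elements into natural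
  numbers and preserves sums, products and the order, so the model inherits all universal sentences.
  The only elements all of whose nontrivial divisors are even are the monomials 2^j t^k (with
  j >= 0 if k = 0): dividing out the lowest term leaves a cofactor with odd constant coefficient,
  which has to be 1. Every positive element lies between such a monomial and its double, and the
  smaller of two such monomials divides the larger. Since 1/3 is not dyadic, t
  has no quotient by 3 with remainder 0, 1 or 2.
*)

theory Submission
  imports Defs "HOL-Computational_Algebra.Polynomial"
begin

section \<open>Soundness of the deduction system\<close>

lemma eval_subst_tm: "eval M e (subst_tm \<sigma> t) = eval M (\<lambda>i. eval M e (\<sigma> i)) t"
  by (induction t) simp_all

lemma eval_lift_tm [simp]: "eval M (case_nat a e) (lift_tm t) = eval M e t"
  by (simp add: lift_tm_def eval_subst_tm)

lemma eval_under_binder: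
  "(\<lambda>i. eval M (case_nat a e) (under_binder \<sigma> i)) = case_nat a (\<lambda>i. eval M e (\<sigma> i))"
  by (auto simp: under_binder_def fun_eq_iff split: nat.split)

lemma sat_subst_fm: "sat M e (subst_fm \<sigma> \<phi>) \<longleftrightarrow> sat M (\<lambda>i. eval M e (\<sigma> i)) \<phi>"
  by (induction \<phi> arbitrary: \<sigma> e) (simp_all add: eval_subst_tm eval_under_binder)

lemma sat_lift_fm [simp]: "sat M (case_nat a e) (lift_fm \<phi>) \<longleftrightarrow> sat M e \<phi>"
  by (simp add: lift_fm_def sat_subst_fm)

lemma sat_inst: "sat M e (inst t \<phi>) \<longleftrightarrow> sat M (case_nat (eval M e t) e) \<phi>"
proof -
  have "(\<lambda>i. eval M e (case_nat t Var i)) = case_nat (eval M e t) e"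
    by (auto simp: fun_eq_iff split: nat.split)
  then show ?thesis
    by (simp add: inst_def sat_subst_fm)
qed

theorem soundness:
  assumes "\<Gamma> \<turnstile> \<phi>" and "\<And>\<psi>. \<psi> \<in> \<Gamma> \<Longrightarrow> sat M e \<psi>"
  shows "sat M e \<phi>"
  using assms
proof (induction arbitrary: e rule: proves.induct)
  case (NegI \<phi> \<Gamma> \<psi>)
  then show ?case by (metis insert_iff sat.simps(3))
next
  case (RAA \<phi> \<Gamma> \<psi>)
  then show ?case by (metis insert_iff sat.simps(3))
next
  case (DisjE \<Gamma> \<phi> \<psi> \<chi>)
  then show ?case by (metis insert_iff sat.simps(5))
next
  case (AllI \<Gamma> \<phi>)
  show ?case
    unfolding sat.simps by (intro allI AllI.IH) (use AllI.prems in auto)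
next
  case (ExE \<Gamma> \<phi> \<psi>)
  then obtain a where "sat M (case_nat a e) \<phi>"
    by fastforce
  then have "sat M (case_nat a e) (lift_fm \<psi>)"
    by (intro ExE.IH) (use ExE.prems in auto)
  then show ?case by simp
qed (auto simp: sat_inst)

text \<open>\<open>models\<close> already ranges over all environments, and every environment is
  \<open>case_nat\<close> of its value at 0 and its tail. Hence axioms and universal sentences can
  be checked on their open matrices.\<close>

lemma models_All:
  fixes M :: "'a struct"
  shows "models M (All \<phi>) \<longleftrightarrow> models M \<phi>"
proof
  assume L: "models M (All \<phi>)"
  show "models M \<phi>"
    unfolding models_def
  proof
    fix e :: "nat \<Rightarrow> 'a"
    have "e = case_nat (e 0) (\<lambda>i. e (Suc i))"
      by (auto simp: fun_eq_iff split: nat.split)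
    then show "sat M e \<phi>"
      using L by (metis models_def sat.simps(7))
  qed
qed (simp add: models_def)

lemma models_All_funpow: "models M ((All ^^ n) \<phi>) \<longleftrightarrow> models M \<phi>"
  by (induction n) (simp_all add: models_All)

lemma models_universal_closure: "models M (universal_closure \<phi>) \<longleftrightarrow> models M \<phi>"
  by (simp add: universal_closure_def models_All_funpow)

lemma models_universal_closure_image:
  assumes "\<phi> \<in> universal_closure ` S" "\<And>e. \<forall>\<psi>\<in>S. sat M e \<psi>"
  shows "models M \<phi>"
  using assms by (auto simp: models_universal_closure) (simp add: models_def)


section \<open>Dyadic numbers\<close>

text \<open>The ring Z[1/2], kept inside the reals so that polynomials over it can use the order,
  the limits and the logarithms available there.\<close>

definition dyadic :: "real set" where
  "dyadic = {c. \<exists>n. c * 2 ^ n \<in> \<int>}"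

lemma dyadic_Ints: "c \<in> \<int> \<Longrightarrow> c \<in> dyadic"
  unfolding dyadic_def by (auto intro!: exI [of _ 0])

lemma dyadic_common:
  assumes "a \<in> dyadic" "b \<in> dyadic"
  obtains n where "a * 2 ^ n \<in> \<int>" "b * 2 ^ n \<in> \<int>"
proof -
  from assms obtain k l where "a * 2 ^ k \<in> \<int>" "b * 2 ^ l \<in> \<int>"
    by (auto simp: dyadic_def)
  then have "(a * 2 ^ k) * 2 ^ l \<in> \<int>" "(b * 2 ^ l) * 2 ^ k \<in> \<int>"
    by simp_all
  then show thesis
    by (intro that [of "k + l"]) (simp_all add: power_add mult_ac)
qed

lemma dyadic_add: "a \<in> dyadic \<Longrightarrow> b \<in> dyadic \<Longrightarrow> a + b \<in> dyadic"
  by (rule dyadic_common [of a b]) (auto simp: dyadic_def distrib_right intro: Ints_add)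

lemma dyadic_diff: "a \<in> dyadic \<Longrightarrow> b \<in> dyadic \<Longrightarrow> a - b \<in> dyadic"
  by (rule dyadic_common [of a b]) (auto simp: dyadic_def left_diff_distrib intro: Ints_diff)

lemma dyadic_mult:
  assumes "a \<in> dyadic" "b \<in> dyadic"
  shows "a * b \<in> dyadic"
proof -
  from assms obtain k l where "a * 2 ^ k \<in> \<int>" "b * 2 ^ l \<in> \<int>"
    by (auto simp: dyadic_def)
  then have "(a * 2 ^ k) * (b * 2 ^ l) \<in> \<int>"
    by (rule Ints_mult)
  then have "(a * b) * 2 ^ (k + l) \<in> \<int>"
    by (simp add: power_add mult_ac)
  then show ?thesis by (auto simp: dyadic_def)
qed

lemma dyadic_sum: "(\<And>i. i \<in> I \<Longrightarrow> f i \<in> dyadic) \<Longrightarrow> sum f I \<in> dyadic"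
  by (induction I rule: infinite_finite_induct) (auto intro: dyadic_add dyadic_Ints)

lemma dyadic_powi: "2 powi j \<in> dyadic"
proof -
  have "(2 :: real) powi j * 2 ^ nat (- j) \<in> \<int>"
  proof (cases "j \<ge> 0")
    case True
    then show ?thesis by (simp add: power_int_def)
  next
    case False
    then show ?thesis by (simp add: power_int_def field_simps)
  qed
  then show ?thesis by (auto simp: dyadic_def)
qed

lemma int_two_power_odd:
  fixes a :: int
  assumes "a \<noteq> 0"
  shows "\<exists>k m. a = 2 ^ k * m \<and> odd m"
  using assms
proof (induction "nat \<bar>a\<bar>" arbitrary: a rule: less_induct)
  case less
  show ?case
  proof (cases "odd a")
    case True
    then show ?thesis by (intro exI [of _ 0] exI [of _ a]) simp
  next
    case False
    then obtain b where b: "a = 2 * b" by auto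
    with less obtain k m where "b = 2 ^ k * m" "odd m"
      by (metis abs_ge_zero abs_mult abs_numeral mult_eq_0_iff nat_less_iff less_le
          mult_2 less_add_same_cancel1 zero_less_abs_iff nat_0_le)
    with b show ?thesis
      by (intro exI [of _ "Suc k"] exI [of _ m]) simp
  qed
qed

text \<open>After denominators are cleared, an integer splits into a power of two and an odd part.
  The last conclusion serves constant coefficients, where only genuine integers are allowed.\<close>

lemma dyadic_cases:
  assumes "c \<in> dyadic" "c \<noteq> 0"
  obtains j m where "c = 2 powi j * of_int m" "odd m" "c \<in> \<int> \<Longrightarrow> j \<ge> 0"
proof -
  \<comment> \<open>The bound on \<open>j\<close> in terms of \<open>n\<close> is what yields
    \<open>j \<ge> 0\<close> for integral \<open>c\<close>, where \<open>n = 0\<close> can be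
    taken.\<close>
  have decompose: "\<exists>j m. c = 2 powi j * of_int m \<and> odd m \<and> j \<ge> - int n" if "c * 2 ^ n \<in> \<int>" for n
  proof -
    from that obtain a :: int where a: "c * 2 ^ n = of_int a"
      by (auto simp: Ints_def)
    with \<open>c \<noteq> 0\<close> have "a \<noteq> 0" by auto
    then obtain k m where "a = 2 ^ k * m" "odd m"
      using int_two_power_odd by blast
    with a have "c = 2 powi (int k - int n) * of_int m"
      by (simp add: power_int_diff field_simps)
    with \<open>odd m\<close> show ?thesis by force
  qed
  show thesis
  proof (cases "c \<in> \<int>")
    case True
    with decompose [of 0] show thesis by (auto intro: that)
  next
    case False
    obtain n where "c * 2 ^ n \<in> \<int>"
      using assms by (auto simp: dyadic_def)
    with False decompose [of n] show thesis by (auto intro: that)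
  qed
qed

lemma powi_Ints: "j \<ge> 0 \<Longrightarrow> 2 powi j \<in> (\<int> :: real set)"
  by (auto simp: power_int_def)

lemma third_not_dyadic: "1 / 3 \<notin> dyadic"
proof
  assume "1 / 3 \<in> dyadic"
  then obtain n and a :: int where "1 / 3 * 2 ^ n = real_of_int a"
    by (auto simp: dyadic_def Ints_def)
  then have "real_of_int (2 ^ n) = real_of_int (3 * a)"
    by (simp add: field_simps)
  then have "3 dvd (2 :: int) ^ n"
    unfolding of_int_eq_iff by simp
  moreover have "\<not> 3 dvd (2 :: int) ^ n"
    by (induction n) (simp, simp, presburger)
  ultimately show False by blast
qed

lemma powi_bracket:
  fixes a :: real
  assumes "a > 0"
  obtains j where "2 powi j \<le> a" "a < 2 powi (j + 1)"
  using floor_log_eq_powr_iff [of a 2 "\<lfloor>log 2 a\<rfloor>"] assms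
  by (metis one_less_numeral_iff semiring_norm(76) powr_real_of_int' zero_le_numeral
      zero_less_numeral less_irrefl)


section \<open>The order on polynomials\<close>

text \<open>In this order the indeterminate is infinitely large: subtracting a constant from it
  leaves the leading coefficient 1.\<close>

lemma poly_less_iff: "p < q \<longleftrightarrow> 0 < lead_coeff (q - p)"
  for p q :: "'a :: linordered_idom poly"
  by (simp add: less_poly_def pos_poly_def)

lemma poly_pos_iff: "0 < p \<longleftrightarrow> 0 < lead_coeff p"
  for p :: "'a :: linordered_idom poly"
  by (simp add: poly_less_iff)

text \<open>If \<open>p\<close> had the larger degree, it would keep its positive leading
  coefficient after subtraction of \<open>q\<close>.\<close>

lemma poly_le_degree:
  fixes p q :: "'a :: linordered_idom poly"
  assumes "0 \<le> p" "p \<le> q"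
  shows "degree p \<le> degree q"
proof (rule ccontr)
  assume "\<not> ?thesis"
  then have "degree q < degree p" by simp
  then have "lead_coeff (p - q) = lead_coeff p"
    using degree_add_eq_left [of "- q" p] by (simp add: coeff_eq_0)
  moreover have "0 < p"
    using \<open>degree q < degree p\<close> \<open>0 \<le> p\<close> by (auto simp: order_le_less)
  ultimately have "q < p"
    by (simp add: poly_less_iff poly_pos_iff)
  with \<open>p \<le> q\<close> show False by simp
qed

text \<open>Reading the coefficient of \<open>p\<close> at \<open>degree q\<close> treats equal and
  smaller degree at once, since it is 0 in the latter case. The difference keeps the degree of
  \<open>q\<close> because its coefficient there is positive.\<close>

lemma poly_less_lead_coeff:
  fixes p q :: "'a :: linordered_idom poly"
  assumes "degree p \<le> degree q" "coeff p (degree q) < lead_coeff q"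
  shows "p < q"
proof -
  have "coeff (q - p) (degree q) > 0" using assms by simp
  moreover have "degree (q - p) \<le> degree q"
    using assms by (intro degree_diff_le) auto
  ultimately have "degree (q - p) = degree q"
    by (metis le_degree less_irrefl le_antisym)
  with \<open>coeff (q - p) (degree q) > 0\<close> show ?thesis
    by (simp add: poly_less_iff)
qed

text \<open>Both the order of vanishing at 0 and the degree are additive on products, and for the
  product both equal \<open>k\<close>. As the order is at most the degree, they agree for each
  factor.\<close>

lemma monom_divisor:
  fixes p q :: "'a :: idom poly"
  assumes "p * q = monom c k" "c \<noteq> 0"
  obtains d l where "p = monom d l"
proof -
  have nz: "p \<noteq> 0" "q \<noteq> 0" "p * q \<noteq> 0"
    using assms by auto
  have "order 0 p + order 0 q = k"
    using order_mult [OF nz(3), of 0] assms by simp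
  moreover have "degree p + degree q = k"
    using degree_mult_eq [OF nz(1,2)] assms by (simp add: degree_monom_eq)
  moreover have "order 0 p \<le> degree p" "order 0 q \<le> degree q"
    using nz by (auto intro: order_degree)
  ultimately have "order 0 p = degree p" by simp
  then have "\<forall>i<degree p. coeff p i = 0"
    using nz monom_1_dvd_iff monom_1_dvd_iff' by (metis order_refl)
  then have "p = monom (lead_coeff p) (degree p)"
    by (intro poly_eqI) (metis coeff_monom coeff_eq_0 nat_neq_iff)
  then show thesis by (rule that)
qed

text \<open>The arguments are powers of two because these will also clear dyadic
  denominators.\<close>

lemma eventually_poly_pos:
  fixes p :: "real poly"
  assumes "0 < p"
  shows "\<forall>\<^sub>F n in sequentially. 0 < poly p (2 ^ n)"
proof -
  obtain b where b: "\<And>x. x \<ge> b \<Longrightarrow> poly p x \<ge> lead_coeff p"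
    using poly_pinfty_gt_lc [of p] assms by (auto simp: poly_pos_iff)
  have "\<forall>\<^sub>F n in sequentially. b \<le> real n"
    using filterlim_real_sequentially by (simp add: filterlim_at_top)
  then have "\<forall>\<^sub>F n in sequentially. b \<le> 2 ^ n"
    by eventually_elim (meson less_imp_le of_nat_less_two_power order_trans)
  then show ?thesis
    by eventually_elim (use b assms in \<open>auto simp: poly_pos_iff intro: less_le_trans\<close>)
qed

lemma eventually_poly_le_iff:
  fixes p q :: "real poly"
  shows "\<forall>\<^sub>F n in sequentially. poly p (2 ^ n) \<le> poly q (2 ^ n) \<longleftrightarrow> p \<le> q"
proof (cases p q rule: linorder_cases)
  case less
  then show ?thesis
    using eventually_poly_pos [of "q - p"] by (auto elim: eventually_mono)
next
  case greater
  then show ?thesis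
    using eventually_poly_pos [of "p - q"] by (auto elim: eventually_mono)
qed simp


section \<open>The nonstandard model\<close>

text \<open>Integral constant coefficients make the order discrete and keep odd and even apart;
  dyadic higher coefficients make every monomial of positive degree divisible by all standard powers
  of two.\<close>

definition dpolys :: "real poly set" where
  "dpolys = {p. 0 \<le> p \<and> coeff p 0 \<in> \<int> \<and> (\<forall>i. coeff p i \<in> dyadic)}"

lemma dpolys_nonneg: "p \<in> dpolys \<Longrightarrow> 0 \<le> p"
  by (simp add: dpolys_def)

lemma dpolys_0: "0 \<in> dpolys"
  by (simp add: dpolys_def dyadic_Ints)

lemma dpolys_1: "1 \<in> dpolys"
  by (simp add: dpolys_def dyadic_Ints)

lemma dpolys_add: "p \<in> dpolys \<Longrightarrow> q \<in> dpolys \<Longrightarrow> p + q \<in> dpolys"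
  by (simp add: dpolys_def dyadic_add)

lemma dpolys_mult: "p \<in> dpolys \<Longrightarrow> q \<in> dpolys \<Longrightarrow> p * q \<in> dpolys"
  by (auto simp: dpolys_def coeff_mult intro!: dyadic_sum dyadic_mult)

lemma dpolys_diff: "p \<in> dpolys \<Longrightarrow> q \<in> dpolys \<Longrightarrow> q \<le> p \<Longrightarrow> p - q \<in> dpolys"
  by (simp add: dpolys_def dyadic_diff)

lemma dpolys_monom:
  assumes "k = 0 \<Longrightarrow> j \<ge> 0"
  shows "monom (2 powi j) k \<in> dpolys"
proof -
  have "0 < monom (2 powi j :: real) k"
    by (simp add: poly_pos_iff degree_monom_eq)
  with assms show ?thesis
    by (auto simp: dpolys_def dyadic_powi powi_Ints dyadic_Ints)
qed

text \<open>A positive element is a positive integer or has positive degree, and in the second case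
  it exceeds all constants.\<close>

lemma dpolys_discrete:
  assumes "p \<in> dpolys" "0 < p"
  shows "1 \<le> p"
proof (cases "degree p = 0")
  case True
  then obtain c where c: "p = [:c:]"
    by (rule degree_eq_zeroE)
  with assms have "c \<in> \<int>" "0 < c"
    by (auto simp: dpolys_def poly_pos_iff)
  then have "1 \<le> c"
    by (auto simp: Ints_def)
  then show ?thesis
    using poly_less_iff [of 1 p] by (cases "c = 1") (auto simp: c one_pCons)
next
  case False
  with assms have "1 < p"
    by (intro poly_less_lead_coeff) (auto simp: poly_pos_iff)
  then show ?thesis by simp
qed

text \<open>Halving keeps the higher coefficients dyadic, so only the constant coefficient can
  obstruct it.\<close>

lemma dpolys_even_iff:
  assumes "p \<in> dpolys"
  shows "(\<exists>q\<in>dpolys. q * 2 = p) \<longleftrightarrow> (\<exists>m. coeff p 0 = 2 * of_int m)"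
proof
  assume "\<exists>q\<in>dpolys. q * 2 = p"
  then show "\<exists>m. coeff p 0 = 2 * of_int m"
    by (auto simp: dpolys_def Ints_def numeral_poly coeff_mult)
next
  assume "\<exists>m. coeff p 0 = 2 * of_int m"
  then have "smult (1 / 2) p \<in> dpolys"
    using assms dyadic_powi [of "- 1"]
    by (auto simp: dpolys_def poly_less_iff order_le_less field_simps
        intro: dyadic_mult [of "1 / 2", simplified])
  moreover have "smult (1 / 2) p * 2 = p"
    by (simp add: numeral_poly)
  ultimately show "\<exists>q\<in>dpolys. q * 2 = p" by blast
qed

section \<open>Powers of two in the model\<close>

definition pow2s :: "real poly set" where
  "pow2s = {monom (2 powi j) k | j k. k = 0 \<longrightarrow> j \<ge> 0}"

lemma pow2s_subset: "pow2s \<subseteq> dpolys"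
  by (auto simp: pow2s_def intro: dpolys_monom)

text \<open>Both factors are monomials. One of positive degree has constant coefficient 0 and is
  even. A constant one is an integer; if odd, it divides a power of two and so is 1.\<close>

lemma pow2s_divisor:
  assumes "y * z \<in> pow2s" "y \<in> dpolys" "z \<in> dpolys"
  shows "y = 1 \<or> (\<exists>q\<in>dpolys. q * 2 = y)"
proof -
  from assms(1) obtain j k where yz: "y * z = monom (2 powi j) k"
    by (auto simp: pow2s_def)
  then obtain d l where y: "y = monom d l"
    by (rule monom_divisor) auto
  from yz obtain d' l' where z: "z = monom d' l'"
    by (subst (asm) mult.commute) (erule monom_divisor, auto)
  have dd': "d * d' = 2 powi j"
  proof -
    have "coeff (y * z) (l + l') = d * d'"
      by (simp add: y z mult_monom)
    moreover have "d * d' \<noteq> 0"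
      using yz by (auto simp: y z mult_monom)
    ultimately show ?thesis
      by (auto simp: yz split: if_splits)
  qed
  show ?thesis
  proof (cases "l = 0")
    case False
    then show ?thesis
      using dpolys_even_iff [OF assms(2)] by (auto simp: y intro!: exI [of _ 0])
  next
    case True
    then have "d \<in> \<int>" "y = [:d:]"
      using assms(2) by (auto simp: y dpolys_def monom_0)
    then obtain a :: int where a: "d = of_int a"
      by (auto simp: Ints_def)
    have "d \<ge> 0"
      using dpolys_nonneg [OF assms(2)] \<open>y = [:d:]\<close>
      by (auto simp: order_le_less poly_pos_iff)
    then have "a \<ge> 0" by (simp add: a)
    show ?thesis
    proof (cases "even a")
      case True
      then show ?thesis
        using dpolys_even_iff [OF assms(2)] by (auto simp: \<open>y = [:d:]\<close> a elim!: evenE)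
    next
      case False
      have "d' \<in> dyadic"
        using assms(3) unfolding dpolys_def z by (metis (mono_tags) coeff_monom mem_Collect_eq)
      then obtain n and b :: int where b: "d' * 2 ^ n = of_int b"
        by (auto simp: dyadic_def Ints_def)
      \<comment> \<open>Here \<open>j\<close> may be negative. Multiplying by \<open>2 ^ N\<close>
        makes \<open>2 powi j\<close> integral, as \<open>2 ^ n\<close> does for \<open>d'\<close>,
        so that divisibility can be argued in the integers.\<close>
      define N where "N = nat (- j)"
      have N: "(2 :: real) powi j * 2 ^ N = 2 ^ nat j"
        by (cases "j \<ge> 0") (auto simp: power_int_def N_def field_simps)
      have "real_of_int (a * (b * 2 ^ N)) = d * (d' * 2 ^ n) * 2 ^ N"
        by (simp add: a b)
      also have "\<dots> = (d * d') * 2 ^ N * 2 ^ n"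
        by (simp only: mult_ac)
      also have "\<dots> = real_of_int (2 ^ (nat j + n))"
        by (simp add: dd' N power_add)
      finally have "real_of_int (a * (b * 2 ^ N)) = real_of_int (2 ^ (nat j + n))" .
      then have "a dvd 2 ^ (nat j + n)"
        unfolding of_int_eq_iff by (metis dvd_triv_left)
      moreover have "coprime a (2 ^ (nat j + n))"
        using False by simp
      ultimately have "is_unit a"
        by (simp only: coprime_absorb_left)
      with \<open>a \<ge> 0\<close> have "a = 1" by auto
      then show ?thesis by (simp add: \<open>y = [:d:]\<close> a one_pCons)
    qed
  qed
qed

lemma pow2s_if_divisors:
  assumes x: "x \<in> dpolys"
    and div: "\<And>y z. y \<in> dpolys \<Longrightarrow> z \<in> dpolys \<Longrightarrow> z * y = x \<Longrightarrow>
      y = 1 \<or> (\<exists>q\<in>dpolys. q * 2 = y)"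
  shows "x \<in> pow2s"
proof -
  have "x \<noteq> 0"
  proof
    assume "x = 0"
    \<comment> \<open>Every element divides 0, but 3 is neither 1 nor even.\<close>
    moreover have "3 \<in> dpolys"
      using dpolys_add [OF dpolys_1 dpolys_add [OF dpolys_1 dpolys_1]] by simp
    ultimately have "\<exists>m. coeff (3 :: real poly) 0 = 2 * of_int m"
      using div [of 3 0] dpolys_0 by (auto simp: dpolys_even_iff)
    then obtain m :: int where "(3 :: real) = 2 * of_int m"
      by (auto simp: numeral_poly)
    then have "real_of_int 3 = real_of_int (2 * m)" by simp
    then show False unfolding of_int_eq_iff by presburger
  qed
  define k where "k = order 0 x"
  define g where "g = poly_shift k x"
  have low: "coeff x i = 0" if "i < k" for i
    using that \<open>x \<noteq> 0\<close> monom_1_dvd_iff monom_1_dvd_iff' unfolding k_def by (metis order_refl)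
  have "coeff x k \<noteq> 0"
  proof
    assume "coeff x k = 0"
    then have "monom 1 (Suc k) dvd x"
      using low by (auto simp: monom_1_dvd_iff' less_Suc_eq)
    then show False
      using \<open>x \<noteq> 0\<close> by (simp add: monom_1_dvd_iff k_def)
  qed
  moreover have "coeff x k \<in> dyadic"
    using x by (simp add: dpolys_def)
  ultimately obtain j m where
    c: "coeff x k = 2 powi j * of_int m" and "odd m" and j: "coeff x k \<in> \<int> \<Longrightarrow> j \<ge> 0"
    using dyadic_cases by metis
  define u where "u = monom (2 powi j :: real) k"
  \<comment> \<open>Scaling turns the constant coefficient of \<open>g\<close>, possibly a proper
    fraction, into the odd integer \<open>m\<close>. Thus \<open>h\<close> lies in
    \<open>dpolys\<close> and is not even.\<close>
  define h where "h = smult (2 powi (- j)) g"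
  have jk: "k = 0 \<Longrightarrow> j \<ge> 0"
    using j x by (auto simp: dpolys_def)
  then have "u \<in> dpolys"
    unfolding u_def by (rule dpolys_monom)
  have uh: "u * h = x"
    by (intro poly_eqI)
      (auto simp: u_def h_def g_def coeff_monom_mult coeff_poly_shift low power_int_minus)
  have h0: "coeff h 0 = of_int m"
    by (simp add: h_def g_def coeff_poly_shift c power_int_minus)
  have "0 < h"
  proof -
    have "0 < u * h"
      using \<open>x \<noteq> 0\<close> dpolys_nonneg [OF x] by (simp add: uh)
    moreover have "0 < u"
      by (simp add: u_def poly_pos_iff degree_monom_eq)
    ultimately show ?thesis by (simp add: zero_less_mult_iff)
  qed
  then have "h \<in> dpolys"
    using x h0 by (auto simp: dpolys_def h_def g_def coeff_poly_shift intro: dyadic_mult dyadic_powi)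
  then have "h = 1 \<or> (\<exists>q\<in>dpolys. q * 2 = h)"
    using div uh \<open>u \<in> dpolys\<close> by blast
  moreover have "\<not> (\<exists>q\<in>dpolys. q * 2 = h)"
  proof
    assume "\<exists>q\<in>dpolys. q * 2 = h"
    then obtain n :: int where "real_of_int m = real_of_int (2 * n)"
      using dpolys_even_iff [OF \<open>h \<in> dpolys\<close>] h0 by auto
    with \<open>odd m\<close> show False unfolding of_int_eq_iff by simp
  qed
  ultimately have "x = u" using uh by simp
  then show ?thesis
    using jk by (auto simp: pow2s_def u_def)
qed

text \<open>Bracketing the leading coefficient between \<open>2 powi j\<close> and its double
  settles the matter unless it equals \<open>2 powi j\<close> and the remaining terms form a
  negative polynomial. Then half the monomial works; the degree is positive in that case, so halving
  stays in \<open>pow2s\<close>.\<close>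

lemma pow2s_bracket:
  assumes "p \<in> dpolys" "0 < p"
  shows "\<exists>u\<in>pow2s. u \<le> p \<and> p < 2 * u"
proof -
  define k where "k = degree p"
  have "0 < lead_coeff p"
    using assms by (simp add: poly_pos_iff)
  then obtain j where j: "2 powi j \<le> lead_coeff p" "lead_coeff p < 2 powi (j + 1)"
    by (rule powi_bracket)
  have double: "2 * monom (2 powi i :: real) k = monom (2 powi (i + 1)) k" for i
    by (simp add: numeral_poly smult_monom power_int_add)
  have below: "monom (2 powi i) k < p" if "2 powi i < lead_coeff p" for i
    using that by (intro poly_less_lead_coeff) (auto simp: k_def degree_monom_eq)
  have above: "p < monom (2 powi (j + 1)) k"
    using j by (intro poly_less_lead_coeff) (auto simp: k_def degree_monom_eq)
  show ?thesis
  proof (cases "monom (2 powi j) k \<le> p")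
    case True
    \<comment> \<open>A positive integer is at least 1, whereas \<open>j < 0\<close> would bound it
      strictly by 1.\<close>
    have "k = 0 \<Longrightarrow> j \<ge> 0"
    proof (rule ccontr)
      assume "k = 0" "\<not> j \<ge> 0"
      then have "lead_coeff p \<in> \<int>"
        using assms by (simp add: dpolys_def k_def)
      with \<open>0 < lead_coeff p\<close> have "1 \<le> lead_coeff p"
        by (auto simp: Ints_def)
      moreover have "(2 :: real) powi (j + 1) \<le> 2 powi 0"
        using \<open>\<not> j \<ge> 0\<close> by (intro power_int_increasing) auto
      ultimately show False using j by simp
    qed
    with True above show ?thesis
      by (intro bexI [of _ "monom (2 powi j) k"]) (auto simp: double pow2s_def)
  next
    case False
    have "k \<noteq> 0"
    proof
      assume "k = 0"
      then have "p = monom (lead_coeff p) k"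
        by (metis degree_eq_zeroE coeff_pCons_0 k_def monom_0)
      moreover have "monom (2 powi j) k = p" if "lead_coeff p = 2 powi j"
        using that calculation by simp
      ultimately show False
        using False below [of j] j by (metis order_le_less)
    qed
    moreover have "(2 :: real) powi (j - 1) < lead_coeff p"
      using j power_int_strict_increasing [of "j - 1" j "2 :: real"] by simp
    ultimately show ?thesis
      using False below [of "j - 1"]
      by (intro bexI [of _ "monom (2 powi (j - 1)) k"]) (auto simp: double pow2s_def)
  qed
qed

text \<open>The order compares degrees first and exponents of 2 next, so subtracting both gives a
  monomial quotient that is still in the model.\<close>

lemma pow2s_dvd:
  assumes "p \<in> pow2s" "q \<in> pow2s" "p \<le> q"
  shows "\<exists>r\<in>dpolys. r * p = q"
proof -
  from assms obtain i k j l where p: "p = monom (2 powi i) k" and q: "q = monom (2 powi j) l"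
    by (auto simp: pow2s_def)
  have "k \<le> l"
    using poly_le_degree [of p q] assms pow2s_subset dpolys_nonneg
    by (auto simp: p q degree_monom_eq)
  have "k = l \<Longrightarrow> i \<le> j"
  proof (rule ccontr)
    assume "k = l" "\<not> i \<le> j"
    then have "q < p"
      by (intro poly_less_lead_coeff)
        (auto simp: p q degree_monom_eq intro: power_int_strict_increasing)
    with \<open>p \<le> q\<close> show False by simp
  qed
  then have "monom (2 powi (j - i)) (l - k) \<in> dpolys"
    using \<open>k \<le> l\<close> by (intro dpolys_monom) auto
  moreover have "monom (2 powi (j - i)) (l - k) * p = q"
    using \<open>k \<le> l\<close> by (simp add: p q mult_monom flip: power_int_add)
  ultimately show ?thesis by blast
qed

text \<open>A remainder below 3 is constant, so comparing the coefficients of degree 1 would make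
  1/3 dyadic.\<close>

lemma dpolys_not_div_3:
  assumes "q \<in> dpolys" "r \<in> dpolys" "r < 3"
  shows "monom 1 1 \<noteq> q * 3 + r"
proof
  assume *: "monom 1 1 = q * 3 + r"
  have "degree r = 0"
    using poly_le_degree [of r 3] assms dpolys_nonneg by auto
  then have "coeff r 1 = 0"
    by (simp add: coeff_eq_0)
  moreover have "coeff (monom 1 1 :: real poly) 1 = coeff (q * 3 + r) 1"
    by (simp only: *)
  ultimately have "coeff q 1 = 1 / 3"
    by (simp add: numeral_poly)
  with assms(1) show False
    using third_not_dyadic by (metis (mono_tags) dpolys_def mem_Collect_eq)
qed

section \<open>The structure and its axioms\<close>

typedef dpoly = dpolys
  morphisms poly_of Abs_dpoly
  using dpolys_0 by blast

text \<open>A structure has its whole carrier type as domain, hence the type \<open>dpoly\<close>.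
  \<open>Abs_dpoly\<close> is specified only on \<open>dpolys\<close>, which the closure lemmas
  guarantee not to be left.\<close>

definition D :: "dpoly struct" where
  "D = \<lparr>zero_of = Abs_dpoly 0, one_of = Abs_dpoly 1,
    add_of = (\<lambda>a b. Abs_dpoly (poly_of a + poly_of b)),
    mul_of = (\<lambda>a b. Abs_dpoly (poly_of a * poly_of b)),
    le_of = (\<lambda>a b. poly_of a \<le> poly_of b)\<rparr>"

lemma poly_of_D [simp]:
  "poly_of (zero_of D) = 0"
  "poly_of (one_of D) = 1"
  "poly_of (add_of D a b) = poly_of a + poly_of b"
  "poly_of (mul_of D a b) = poly_of a * poly_of b"
  "le_of D a b \<longleftrightarrow> poly_of a \<le> poly_of b"
  by (simp_all add: D_def Abs_dpoly_inverse dpolys_0 dpolys_1 dpolys_add dpolys_mult poly_of)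

lemma eq_dpoly_iff: "a = b \<longleftrightarrow> poly_of a = poly_of b"
  by (simp add: poly_of_inject)

lemma Ex_dpoly: "(\<exists>a. P a) \<longleftrightarrow> (\<exists>p\<in>dpolys. P (Abs_dpoly p))"
  by (metis Abs_dpoly_cases)

lemma All_dpoly: "(\<forall>a. P a) \<longleftrightarrow> (\<forall>p\<in>dpolys. P (Abs_dpoly p))"
  by (metis Abs_dpoly_cases)

lemma sat_Lt_D: "sat D e (s \<^bold>< t) \<longleftrightarrow> poly_of (eval D e s) < poly_of (eval D e t)"
  by (auto simp: Lt_def eq_dpoly_iff)

lemma sat_Dvd_D:
  "sat D e (s \<^bold>dvd t) \<longleftrightarrow> (\<exists>q\<in>dpolys. q * poly_of (eval D e s) = poly_of (eval D e t))"
  by (simp add: Dvd_def eq_dpoly_iff Ex_dpoly Abs_dpoly_inverse cong: bex_cong)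

text \<open>Both directions matter: pa19 asserts that something is a power of two, and pa20 assumes
  it.\<close>

lemma sat_Pow2_D: "sat D e (Pow2 t) \<longleftrightarrow> poly_of (eval D e t) \<in> pow2s"
proof -
  have "sat D e (Pow2 t) \<longleftrightarrow> (\<forall>y\<in>dpolys. (\<exists>z\<in>dpolys. z * y = poly_of (eval D e t)) \<longrightarrow>
      y = 1 \<or> (\<exists>q\<in>dpolys. q * 2 = y))"
    by (simp add: Pow2_def sat_Dvd_D eq_dpoly_iff All_dpoly Abs_dpoly_inverse cong: ball_cong)
  also have "\<dots> \<longleftrightarrow> poly_of (eval D e t) \<in> pow2s"
    using pow2s_if_divisors [OF poly_of] pow2s_divisor by (metis mult.commute)
  finally show ?thesis .
qed

lemma models_PA_smu_minus:
  assumes "\<phi> \<in> PA_smu_minus"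
  shows "models D \<phi>"
proof -
  \<comment> \<open>\<open>disc\<close>, \<open>diff\<close> and \<open>brk\<close> are pa11, pa15
    and pa19 in terms of polynomials; \<open>pow2s_dvd\<close> is pa20. The other axioms are algebra
    in an ordered ring.\<close>
  have disc: "p = q" if "p \<in> dpolys" "q \<in> dpolys" "p \<le> q" "\<not> p + 1 \<le> q" for p q
    using that dpolys_discrete [of "q - p"] dpolys_diff [of q p]
    by (auto simp: order_le_less algebra_simps)
  have diff: "\<exists>r\<in>dpolys. p = q + r" if "p \<in> dpolys" "q \<in> dpolys" "q \<le> p" for p q
    using that dpolys_diff [of p q] by (intro bexI [of _ "p - q"]) auto
  have brk: "\<exists>u\<in>dpolys. u \<in> pow2s \<and> u \<le> p + 1 \<and> p + 1 < 2 * u" if "p \<in> dpolys" for p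
    using that pow2s_bracket [of "p + 1"] pow2s_subset dpolys_add [OF that dpolys_1]
      dpolys_nonneg [OF that] by (auto simp: add_nonneg_pos)
  show ?thesis
    using assms unfolding PA_smu_minus_def Let_def
    by (rule models_universal_closure_image)
      (auto simp: eq_dpoly_iff sat_Lt_D sat_Dvd_D sat_Pow2_D Ex_dpoly Abs_dpoly_inverse
        lift_tm_def dpolys_nonneg poly_of mult_right_mono
        intro: disc [OF poly_of poly_of] diff brk pow2s_dvd cong: bex_cong,
        simp_all add: algebra_simps)
qed

lemma not_models_pa16_3: "\<not> sat D e pa16_3"
proof -
  have "monom 1 1 \<in> dpolys"
    using dpolys_monom [of 1 0] by simp
  then show ?thesis
    using dpolys_not_div_3
    by (auto simp: pa16_3_def sat_Lt_D eq_dpoly_iff All_dpoly Ex_dpoly Abs_dpoly_inverse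
        intro!: bexI [of _ "monom 1 1"])
qed


section \<open>Universal sentences\<close>

text \<open>A large power of two clears the denominator of each of the finitely many nonconstant
  terms; the constant term is integral from the start. Nonnegativity comes from the order.\<close>

lemma eventually_poly_Nats:
  assumes "p \<in> dpolys"
  shows "\<forall>\<^sub>F n in sequentially. poly p (2 ^ n) \<in> \<nat>"
proof -
  have "\<forall>\<^sub>F n in sequentially. coeff p i * (2 ^ n) ^ i \<in> \<int>" for i
  proof (cases "i = 0")
    case True
    then show ?thesis using assms by (simp add: dpolys_def)
  next
    case False
    obtain N where N: "coeff p i * 2 ^ N \<in> \<int>"
      using assms by (auto simp: dpolys_def dyadic_def)
    have "coeff p i * (2 ^ n) ^ i \<in> \<int>" if "n \<ge> N" for n
    proof -
      have "N \<le> n * i"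
        using False that by (metis One_nat_def Suc_leI mult_le_mono mult.right_neutral neq0_conv)
      then have "coeff p i * (2 ^ n) ^ i = (coeff p i * 2 ^ N) * 2 ^ (n * i - N)"
        by (simp add: power_mult [symmetric] power_add [symmetric])
      also have "\<dots> \<in> \<int>"
        using N by (rule Ints_mult) simp
      finally show ?thesis .
    qed
    then show ?thesis by (auto simp: eventually_sequentially)
  qed
  then have "\<forall>\<^sub>F n in sequentially. \<forall>i\<in>{..degree p}. coeff p i * (2 ^ n) ^ i \<in> \<int>"
    by (intro eventually_ball_finite) auto
  moreover have "\<forall>\<^sub>F n in sequentially. poly 0 (2 ^ n) \<le> poly p (2 ^ n)"
    using eventually_poly_le_iff [of 0 p] dpolys_nonneg [OF assms] by simp
  ultimately show ?thesis
  proof eventually_elim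
    case (elim n)
    then have "poly p (2 ^ n) \<in> \<int>"
      by (auto simp: poly_altdef)
    with elim show ?case by (simp add: Nats_altdef2)
  qed
qed

text \<open>\<open>nat\<close> and the floor only make the function total: for each
  \<open>i\<close>, the value of the polynomial is itself a natural number once \<open>n\<close> is
  large.\<close>

definition std_env :: "(nat \<Rightarrow> dpoly) \<Rightarrow> nat \<Rightarrow> nat \<Rightarrow> nat" where
  "std_env e n i = nat \<lfloor>poly (poly_of (e i)) (2 ^ n)\<rfloor>"

text \<open>How large \<open>n\<close> must be depends on the variable, but a term contains only
  finitely many.\<close>

lemma eventually_eval_std_env:
  "\<forall>\<^sub>F n in sequentially. real (eval N0 (std_env e n) t) = poly (poly_of (eval D e t)) (2 ^ n)"
proof (induction t)
  case (Var i)
  show ?case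
    using eventually_poly_Nats [OF poly_of [of "e i"]]
    by eventually_elim (auto simp: std_env_def elim!: Nats_cases)
next
  case (Add s t)
  then show ?case by eventually_elim (simp add: N0_def)
next
  case (Mul s t)
  then show ?case by eventually_elim (simp add: N0_def)
qed (simp_all add: N0_def)

text \<open>The equivalence, unlike an implication, passes through negation and implication.
  Equality of polynomials is handled as two inequalities.\<close>

lemma eventually_sat_std_env:
  assumes "quantifier_free \<phi>"
  shows "\<forall>\<^sub>F n in sequentially. sat N0 (std_env e n) \<phi> \<longleftrightarrow> sat D e \<phi>"
  using assms
proof (induction \<phi>)
  case (Eq s t)
  let ?p = "poly_of (eval D e s)" and ?q = "poly_of (eval D e t)"
  show ?case
    using eventually_eval_std_env [of e s] eventually_eval_std_env [of e t]
      eventually_poly_le_iff [of ?p ?q] eventually_poly_le_iff [of ?q ?p]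
  proof eventually_elim
    case (elim n)
    then show ?case
      by (metis eq_dpoly_iff of_nat_eq_iff order.antisym order_refl sat.simps(1))
  qed
next
  case (Le s t)
  show ?case
    using eventually_eval_std_env [of e s] eventually_eval_std_env [of e t]
      eventually_poly_le_iff [of "poly_of (eval D e s)" "poly_of (eval D e t)"]
    by eventually_elim (simp add: N0_def flip: of_nat_le_iff [where 'a = real])
next
  case (Neg \<phi>)
  then show ?case by (auto elim: eventually_mono)
next
  case (Conj \<phi> \<psi>)
  then have "quantifier_free \<phi>" "quantifier_free \<psi>" by auto
  from Conj.IH(1) [OF this(1)] Conj.IH(2) [OF this(2)] show ?case
    by eventually_elim simp
next
  case (Disj \<phi> \<psi>)
  then have "quantifier_free \<phi>" "quantifier_free \<psi>" by auto
  from Disj.IH(1) [OF this(1)] Disj.IH(2) [OF this(2)] show ?case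
    by eventually_elim simp
next
  case (Imp \<phi> \<psi>)
  then have "quantifier_free \<phi>" "quantifier_free \<psi>" by auto
  from Imp.IH(1) [OF this(1)] Imp.IH(2) [OF this(2)] show ?case
    by eventually_elim simp
qed auto

text \<open>A counterexample to the matrix in \<open>D\<close> would, for some \<open>n\<close>,
  become one in \<open>N0\<close>.\<close>

lemma models_Th_univ_N0:
  assumes "\<phi> \<in> Th_univ_N0"
  shows "models D \<phi>"
proof -
  obtain k \<psi> where \<phi>: "\<phi> = (All ^^ k) \<psi>" and "quantifier_free \<psi>" and "models N0 \<phi>"
    using assms by (auto simp: Th_univ_N0_def)
  then have "models N0 \<psi>" by (simp add: models_All_funpow)
  have "sat D e \<psi>" for e
  proof -
    obtain n where "sat N0 (std_env e n) \<psi> \<longleftrightarrow> sat D e \<psi>"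
      using eventually_sat_std_env [OF \<open>quantifier_free \<psi>\<close>, of e]
      by (auto simp: eventually_sequentially)
    then show ?thesis using \<open>models N0 \<psi>\<close> by (simp add: models_def)
  qed
  then show ?thesis by (simp add: \<phi> models_All_funpow) (simp add: models_def)
qed

theorem corollary11:
  "\<not> (PA_smu_minus \<union> Th_univ_N0 \<turnstile> pa16_3) \<and>
   \<not> (\<forall>\<phi> \<in> pa16. PA_smu_minus \<union> Th_univ_N0 \<turnstile> \<phi>) \<and>
   \<not> (\<forall>\<phi> \<in> pa16. PA_smu_minus \<turnstile> \<phi>)"
proof -
  \<comment> \<open>Allowing any subset of the axioms also covers \<open>PA_smu_minus\<close>
    alone.\<close>
  have unprovable: "\<not> (\<Gamma> \<turnstile> pa16_3)" if "\<Gamma> \<subseteq> PA_smu_minus \<union> Th_univ_N0" for \<Gamma>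
  proof
    assume "\<Gamma> \<turnstile> pa16_3"
    moreover have "models D \<psi>" if "\<psi> \<in> \<Gamma>" for \<psi>
      using that \<open>\<Gamma> \<subseteq> _\<close> models_PA_smu_minus models_Th_univ_N0 by blast
    ultimately have "sat D (\<lambda>_. zero_of D) pa16_3"
      by (auto simp: models_def intro: soundness)
    then show False by (simp add: not_models_pa16_3)
  qed
  moreover have "pa16_3 \<in> pa16"
    by (auto simp: pa16_def pa16_3_eq)
  ultimately show ?thesis by blast
qed

end
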